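(* For every $n\ge1$, $$|\mathcal{RS}_n(132,312)|=|\mathcal{RS}_n(213,312)|=n \qquad\text{and}\qquad |\mathcal{RS}_n(231,312)|=F_{n+1},$$ where $F_m$ denotes the $m$-th Fibonacci number.
   Context: $\mathfrak{S}_n$ is the set of permutations of $\{1,\dots,n\}$, written in one-line notation $\pi=\pi_1\pi_2\dots\pi_n$. A permutation $\pi\in\mathfrak{S}_n$ is simsun if for every $3\le k\le n$, the subword of $\pi_1\pi_2\dots\pi_n$ consisting of the entries in $\{1,\dots,k\}$ (kept in their order) has no double descent, i.e. no three entries that are consecutive in that subword and in decreasing order. A permutation $\pi\in\mathfrak{S}_n$ avoids the pattern $\sigma\in\mathfrak{S}_k$ if there are no indices $i_1<i_2<\dots<i_k$ such that $\pi_{i_1}\pi_{i_2}\dots\pi_{i_k}$ is in the same relative order as $\sigma$. $\mathcal{RS}_n(\sigma,\tau)$ is the set of simsun permutations in $\mathfrak{S}_n$ avoiding both $\sigma$ and $\tau$. The Fibonacci numbers are given by $\sum_{n\ge0}F_nz^n=\frac{z}{1-z-z^2}$, i.e. $F_0=0$, $F_1=1$, $F_{n+2}=F_{n+1}+F_n$. *)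

theory Defs
  imports "HOL-Combinatorics.Multiset_Permutations" "HOL-Number_Theory.Fib"
begin

text \<open>
  A permutation of \<open>{1..n}\<close> is given by its one-line notation, a member of
  \<^term>\<open>permutations_of_set {1..n}\<close>, and a pattern by a list in the same way. List positions
  are counted from \<open>0\<close>.
\<close>

definition has_double_descent :: "nat list \<Rightarrow> bool" where
  "has_double_descent xs \<longleftrightarrow>
     (\<exists>i. i + 2 < length xs \<and> xs ! i > xs ! (i + 1) \<and> xs ! (i + 1) > xs ! (i + 2))"

definition simsun :: "nat list \<Rightarrow> bool" where
  "simsun \<pi> \<longleftrightarrow>
     (\<forall>k. 3 \<le> k \<and> k \<le> length \<pi> \<longrightarrow> \<not> has_double_descent (filter (\<lambda>x. x \<in> {1..k}) \<pi>))"

definition contains_pattern :: "nat list \<Rightarrow> nat list \<Rightarrow> bool" where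
  "contains_pattern \<pi> \<sigma> \<longleftrightarrow>
     (\<exists>f :: nat \<Rightarrow> nat.
        strict_mono_on {..<length \<sigma>} f \<and>
        (\<forall>a<length \<sigma>. f a < length \<pi>) \<and>
        (\<forall>a<length \<sigma>. \<forall>b<length \<sigma>. \<pi> ! f a < \<pi> ! f b \<longleftrightarrow> \<sigma> ! a < \<sigma> ! b))"

definition avoids :: "nat list \<Rightarrow> nat list \<Rightarrow> bool" where
  "avoids \<pi> \<sigma> \<longleftrightarrow> \<not> contains_pattern \<pi> \<sigma>"

definition RS :: "nat \<Rightarrow> nat list \<Rightarrow> nat list \<Rightarrow> nat list set" where
  "RS n \<sigma> \<tau> =
     {\<pi> \<in> permutations_of_set {1..n}. simsun \<pi> \<and> avoids \<pi> \<sigma> \<and> avoids \<pi> \<tau>}"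

end

theory Submission
  imports Defs "HOL-Library.Sublist"
begin

text \<open>
  Let \<open>N\<close> be the largest entry of a simsun permutation that avoids 312. The entries after \<open>N\<close>
  decrease, since an ascent among them would complete \<open>N\<close> to a 312; and two of them would form
  a double descent with \<open>N\<close>. So \<open>N\<close> is the last or the second-to-last entry. Conversely, \<open>N\<close> may
  be inserted at either place: being larger than everything else, it could only be the
  first entry of a double descent or play the 3 of a 312, and at most one entry follows it.
  Hence the permutations under study arise from those of size one less by appending \<open>N\<close> or
  by placing it just before the last entry, with the second pattern \<open>\<sigma>\<close> as the only further
  restriction (\<open>RS_Suc_iff\<close>). Since \<open>N\<close> must play the 3 in any new occurrence of \<open>\<sigma>\<close>, this
  restriction is easy to read off:

  \<^item> For 132, no entry before \<open>N\<close> may be smaller than an entry after it. Appending is always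
    possible; inserting before the last entry \<open>c\<close> is possible just if \<open>c = 1\<close>. Exactly one
    member of each size ends in 1, namely \<open>2 3 ... n 1\<close>, so the number grows by one.

  \<^item> For 213, the entries before \<open>N\<close> must increase. Only the identity can be extended by
    appending. By induction all entries but the last increase in each member, so inserting
    before the last entry is always possible, and the number again grows by one.

  \<^item> For 231, no entry before \<open>N\<close> may be larger than an entry after it. Appending is always
    possible; inserting before \<open>c\<close> is possible only if \<open>c = N - 1\<close>, and then removing \<open>N\<close> and
    \<open>N - 1\<close> leaves an arbitrary member of size \<open>N - 2\<close>. This is the Fibonacci recurrence.
\<close>

section \<open>Pattern occurrences as subsequences\<close>

lemma subseq_obtain_positions:
  assumes "subseq xs ys"
  shows "\<exists>f. strict_mono_on {..<length xs} f \<and>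
             (\<forall>a<length xs. f a < length ys \<and> ys ! f a = xs ! a)"
  using assms
proof (induction rule: list_emb.induct)
  case (list_emb_Nil ys)
  then show ?case by (auto simp: strict_mono_on_def)
next
  case (list_emb_Cons xs ys y)
  then obtain f where "strict_mono_on {..<length xs} f"
    "\<forall>a<length xs. f a < length ys \<and> ys ! f a = xs ! a" by blast
  then show ?case
    by (intro exI[of _ "Suc \<circ> f"]) (auto simp: strict_mono_on_def)
next
  case (list_emb_Cons2 x y xs ys)
  then obtain f where "strict_mono_on {..<length xs} f"
    "\<forall>a<length xs. f a < length ys \<and> ys ! f a = xs ! a" by blast
  with list_emb_Cons2.hyps show ?case
    by (intro exI[of _ "\<lambda>a. case a of 0 \<Rightarrow> 0 | Suc b \<Rightarrow> Suc (f b)"])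
       (auto simp: strict_mono_on_def nth_Cons split: nat.splits)
qed

text \<open>
  The induction runs over the number \<open>k\<close> of positions used so far, inside the prefix
  \<open>take t ys\<close> for any bound \<open>t\<close> on these positions: the first \<open>k\<close> of them lie below \<open>f k\<close>, so
  the induction hypothesis applies with \<open>t = f k\<close>, and the entry at \<open>f k\<close> is appended.
\<close>

lemma subseq_nth_strict_mono:
  assumes "strict_mono_on {..<m} f" "\<forall>a<m. f a < length ys"
  shows "subseq (map (\<lambda>a. ys ! f a) [0..<m]) ys"
proof -
  have "k \<le> m \<Longrightarrow> \<forall>a<k. f a < t \<Longrightarrow> t \<le> length ys \<Longrightarrow>
        subseq (map (\<lambda>a. ys ! f a) [0..<k]) (take t ys)" for k t
  proof (induction k arbitrary: t)
    case 0
    then show ?case by simp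
  next
    case (Suc k)
    have "\<forall>a<k. f a < f k"
      using assms(1) Suc.prems(1) by (auto simp: strict_mono_on_def)
    moreover have fk: "f k < t" "t \<le> length ys" using Suc.prems by auto
    ultimately have "subseq (map (\<lambda>a. ys ! f a) [0..<k]) (take (f k) ys)"
      using Suc.prems by (intro Suc.IH) auto
    moreover have "take (Suc (f k)) ys = take (f k) ys @ [ys ! f k]"
      using fk by (intro take_Suc_conv_app_nth) auto
    ultimately have "subseq (map (\<lambda>a. ys ! f a) [0..<Suc k]) (take (Suc (f k)) ys)"
      by simp
    also have "take (Suc (f k)) ys = take (Suc (f k)) (take t ys)"
      using fk by (simp add: min_def)
    also have "subseq \<dots> (take t ys)"
      by (rule prefix_imp_subseq[OF take_is_prefix])
    finally show ?case .
  qed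
  from this[of m "length ys"] show ?thesis using assms(2) by simp
qed

text \<open>
  Working with the entries of an occurrence instead of its index function makes pattern
  containment compatible with append, which inserting an entry requires.
\<close>

lemma contains_pattern_iff_subseq:
  "contains_pattern \<pi> \<sigma> \<longleftrightarrow>
     (\<exists>xs. subseq xs \<pi> \<and> length xs = length \<sigma> \<and>
        (\<forall>a<length \<sigma>. \<forall>b<length \<sigma>. xs ! a < xs ! b \<longleftrightarrow> \<sigma> ! a < \<sigma> ! b))"
proof
  assume "contains_pattern \<pi> \<sigma>"
  then obtain f where f: "strict_mono_on {..<length \<sigma>} f" "\<forall>a<length \<sigma>. f a < length \<pi>"
    "\<forall>a<length \<sigma>. \<forall>b<length \<sigma>. \<pi> ! f a < \<pi> ! f b \<longleftrightarrow> \<sigma> ! a < \<sigma> ! b"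
    unfolding contains_pattern_def by blast
  then show "\<exists>xs. subseq xs \<pi> \<and> length xs = length \<sigma> \<and>
        (\<forall>a<length \<sigma>. \<forall>b<length \<sigma>. xs ! a < xs ! b \<longleftrightarrow> \<sigma> ! a < \<sigma> ! b)"
    by (intro exI[of _ "map (\<lambda>a. \<pi> ! f a) [0..<length \<sigma>]"])
       (auto intro: subseq_nth_strict_mono)
next
  assume "\<exists>xs. subseq xs \<pi> \<and> length xs = length \<sigma> \<and>
        (\<forall>a<length \<sigma>. \<forall>b<length \<sigma>. xs ! a < xs ! b \<longleftrightarrow> \<sigma> ! a < \<sigma> ! b)"
  then obtain xs where xs: "subseq xs \<pi>" "length xs = length \<sigma>"
    "\<forall>a<length \<sigma>. \<forall>b<length \<sigma>. xs ! a < xs ! b \<longleftrightarrow> \<sigma> ! a < \<sigma> ! b" by blast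
  with subseq_obtain_positions[OF xs(1)] show "contains_pattern \<pi> \<sigma>"
    unfolding contains_pattern_def by metis
qed

lemma avoids_subseq: "avoids \<pi> \<sigma> \<Longrightarrow> subseq \<tau> \<pi> \<Longrightarrow> avoids \<tau> \<sigma>"
  unfolding avoids_def contains_pattern_iff_subseq by (meson subseq_order.order_trans)

lemma contains_pattern_three:
  "contains_pattern \<pi> [p, q, r] \<longleftrightarrow>
     (\<exists>x y z. subseq [x, y, z] \<pi> \<and>
        (x < y \<longleftrightarrow> p < q) \<and> (y < x \<longleftrightarrow> q < p) \<and> (x < z \<longleftrightarrow> p < r) \<and>
        (z < x \<longleftrightarrow> r < p) \<and> (y < z \<longleftrightarrow> q < r) \<and> (z < y \<longleftrightarrow> r < q))"
proof -
  have ex: "(\<exists>xs. length xs = length [p, q, r] \<and> P xs) \<longleftrightarrow> (\<exists>x y z. P [x, y, z])" for P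
    by (auto simp: length_Suc_conv; blast)
  have "contains_pattern \<pi> [p, q, r] \<longleftrightarrow>
     (\<exists>xs. length xs = length [p, q, r] \<and> (subseq xs \<pi> \<and>
        (\<forall>a<length [p, q, r]. \<forall>b<length [p, q, r]. xs ! a < xs ! b \<longleftrightarrow> [p, q, r] ! a < [p, q, r] ! b)))"
    unfolding contains_pattern_iff_subseq by blast
  also have "\<dots> \<longleftrightarrow> (\<exists>x y z. subseq [x, y, z] \<pi> \<and>
        (\<forall>a<length [p, q, r]. \<forall>b<length [p, q, r]. [x, y, z] ! a < [x, y, z] ! b \<longleftrightarrow> [p, q, r] ! a < [p, q, r] ! b))"
    by (rule ex)
  finally show ?thesis by (simp add: All_less_Suc2 conj_ac)
qed

lemma contains_pattern_312:
  "contains_pattern \<pi> [3, 1, 2] \<longleftrightarrow> (\<exists>x y z. subseq [x, y, z] \<pi> \<and> y < z \<and> z < x)"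
proof -
  have "((x < y \<longleftrightarrow> 3 < (1::nat)) \<and> (y < x \<longleftrightarrow> 1 < (3::nat)) \<and>
      (x < z \<longleftrightarrow> 3 < (2::nat)) \<and> (z < x \<longleftrightarrow> 2 < (3::nat)) \<and>
      (y < z \<longleftrightarrow> 1 < (2::nat)) \<and> (z < y \<longleftrightarrow> 2 < (1::nat))) \<longleftrightarrow> y < z \<and> z < x"
    for x y z :: nat by auto
  then show ?thesis unfolding contains_pattern_three by simp
qed

lemma contains_pattern_132:
  "contains_pattern \<pi> [1, 3, 2] \<longleftrightarrow> (\<exists>x y z. subseq [x, y, z] \<pi> \<and> x < z \<and> z < y)"
proof -
  have "((x < y \<longleftrightarrow> 1 < (3::nat)) \<and> (y < x \<longleftrightarrow> 3 < (1::nat)) \<and>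
      (x < z \<longleftrightarrow> 1 < (2::nat)) \<and> (z < x \<longleftrightarrow> 2 < (1::nat)) \<and>
      (y < z \<longleftrightarrow> 3 < (2::nat)) \<and> (z < y \<longleftrightarrow> 2 < (3::nat))) \<longleftrightarrow> x < z \<and> z < y"
    for x y z :: nat by auto
  then show ?thesis unfolding contains_pattern_three by simp
qed

lemma contains_pattern_213:
  "contains_pattern \<pi> [2, 1, 3] \<longleftrightarrow> (\<exists>x y z. subseq [x, y, z] \<pi> \<and> y < x \<and> x < z)"
proof -
  have "((x < y \<longleftrightarrow> 2 < (1::nat)) \<and> (y < x \<longleftrightarrow> 1 < (2::nat)) \<and>
      (x < z \<longleftrightarrow> 2 < (3::nat)) \<and> (z < x \<longleftrightarrow> 3 < (2::nat)) \<and>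
      (y < z \<longleftrightarrow> 1 < (3::nat)) \<and> (z < y \<longleftrightarrow> 3 < (1::nat))) \<longleftrightarrow> y < x \<and> x < z"
    for x y z :: nat by auto
  then show ?thesis unfolding contains_pattern_three by simp
qed

lemma contains_pattern_231:
  "contains_pattern \<pi> [2, 3, 1] \<longleftrightarrow> (\<exists>x y z. subseq [x, y, z] \<pi> \<and> z < x \<and> x < y)"
proof -
  have "((x < y \<longleftrightarrow> 2 < (3::nat)) \<and> (y < x \<longleftrightarrow> 3 < (2::nat)) \<and>
      (x < z \<longleftrightarrow> 2 < (1::nat)) \<and> (z < x \<longleftrightarrow> 1 < (2::nat)) \<and>
      (y < z \<longleftrightarrow> 3 < (1::nat)) \<and> (z < y \<longleftrightarrow> 1 < (3::nat))) \<longleftrightarrow> z < x \<and> x < y"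
    for x y z :: nat by auto
  then show ?thesis unfolding contains_pattern_three by simp
qed

section \<open>Inserting a new maximum\<close>

lemma subseq_insert_iff:
  "subseq xs (\<rho> @ m # \<omega>) \<longleftrightarrow> subseq xs (\<rho> @ \<omega>) \<or>
     (\<exists>us vs. xs = us @ m # vs \<and> subseq us \<rho> \<and> subseq vs \<omega>)"
proof
  assume "subseq xs (\<rho> @ m # \<omega>)"
  then obtain us vs where xs: "xs = us @ vs" "subseq us \<rho>" "subseq vs (m # \<omega>)"
    by (auto simp: subseq_append_iff)
  from xs(3) show "subseq xs (\<rho> @ \<omega>) \<or>
     (\<exists>us vs. xs = us @ m # vs \<and> subseq us \<rho> \<and> subseq vs \<omega>)"
  proof cases
    case list_emb_Nil
    then show ?thesis using xs by (auto simp: list_emb_append2)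
  next
    case (list_emb_Cons)
    then show ?thesis using xs by (auto simp: list_emb_append_mono)
  next
    case (list_emb_Cons2)
    then show ?thesis using xs by auto
  qed
next
  assume "subseq xs (\<rho> @ \<omega>) \<or>
     (\<exists>us vs. xs = us @ m # vs \<and> subseq us \<rho> \<and> subseq vs \<omega>)"
  moreover have "subseq (\<rho> @ \<omega>) (\<rho> @ m # \<omega>)"
    by (simp add: list_emb_append_mono list_emb_Cons)
  ultimately show "subseq xs (\<rho> @ m # \<omega>)"
    by (auto intro: subseq_order.order_trans list_emb_append_mono)
qed

lemma three_eq_append_Cons:
  "[x, y, z] = us @ m # vs \<longleftrightarrow>
     us = [] \<and> x = m \<and> vs = [y, z] \<or> us = [x] \<and> y = m \<and> vs = [z] \<or>
     us = [x, y] \<and> z = m \<and> vs = []"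
  by (cases us rule: list.exhaust; cases "tl us"; cases "tl (tl us)") auto

lemma subseq_three_insert_iff:
  "subseq [x, y, z] (\<rho> @ m # \<omega>) \<longleftrightarrow> subseq [x, y, z] (\<rho> @ \<omega>) \<or>
     x = m \<and> subseq [y, z] \<omega> \<or> y = m \<and> x \<in> set \<rho> \<and> z \<in> set \<omega> \<or>
     z = m \<and> subseq [x, y] \<rho>"
  unfolding subseq_insert_iff three_eq_append_Cons
  by (simp add: conj_disj_distribR ex_disj_distrib subseq_singleton_left)

lemma subseq_set_subset: "subseq xs ys \<Longrightarrow> set xs \<subseteq> set ys"
  by (auto dest: list_emb_set)

text \<open>
  In a new occurrence of a pattern of length 3, the inserted maximum plays the 3. What
  is left is a condition on two entries, on the sides of the maximum that the pattern
  prescribes.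
\<close>

context
  fixes \<rho> \<omega> :: "nat list" and m :: nat
  assumes max: "\<forall>x\<in>set (\<rho> @ \<omega>). x < m"
begin

lemma subseq_less_max:
  "subseq [y, z] \<omega> \<Longrightarrow> y < m \<and> z < m" "subseq [y, z] \<rho> \<Longrightarrow> y < m \<and> z < m"
  "subseq [x, y, z] (\<rho> @ \<omega>) \<Longrightarrow> x < m \<and> y < m \<and> z < m"
  using max by (auto dest!: subseq_set_subset)

lemma avoids_312_insert_max:
  "avoids (\<rho> @ m # \<omega>) [3, 1, 2] \<longleftrightarrow>
     avoids (\<rho> @ \<omega>) [3, 1, 2] \<and> \<not> (\<exists>y z. subseq [y, z] \<omega> \<and> y < z)"
proof -
  have "subseq [x, y, z] (\<rho> @ m # \<omega>) \<and> y < z \<and> z < x \<longleftrightarrow>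
      subseq [x, y, z] (\<rho> @ \<omega>) \<and> y < z \<and> z < x \<or>
      x = m \<and> subseq [y, z] \<omega> \<and> y < z" for x y z
  proof -
    have "x \<in> set \<rho> \<Longrightarrow> x < m" "z \<in> set \<omega> \<Longrightarrow> z < m" using max by auto
    then show ?thesis
      unfolding subseq_three_insert_iff
      using subseq_less_max(1)[of y z] subseq_less_max(2)[of x y] subseq_less_max(3)[of x y z]
      by auto
  qed
  then show ?thesis unfolding avoids_def contains_pattern_312 by blast
qed

lemma avoids_132_insert_max:
  "avoids (\<rho> @ m # \<omega>) [1, 3, 2] \<longleftrightarrow>
     avoids (\<rho> @ \<omega>) [1, 3, 2] \<and> \<not> (\<exists>x\<in>set \<rho>. \<exists>z\<in>set \<omega>. x < z)"
proof -
  have "subseq [x, y, z] (\<rho> @ m # \<omega>) \<and> x < z \<and> z < y \<longleftrightarrow>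
      subseq [x, y, z] (\<rho> @ \<omega>) \<and> x < z \<and> z < y \<or>
      y = m \<and> x \<in> set \<rho> \<and> z \<in> set \<omega> \<and> x < z" for x y z
  proof -
    have "x \<in> set \<rho> \<Longrightarrow> x < m" "z \<in> set \<omega> \<Longrightarrow> z < m" using max by auto
    then show ?thesis
      unfolding subseq_three_insert_iff
      using subseq_less_max(1)[of y z] subseq_less_max(2)[of x y] subseq_less_max(3)[of x y z]
      by auto
  qed
  then show ?thesis unfolding avoids_def contains_pattern_132 by blast
qed

lemma avoids_213_insert_max:
  "avoids (\<rho> @ m # \<omega>) [2, 1, 3] \<longleftrightarrow>
     avoids (\<rho> @ \<omega>) [2, 1, 3] \<and> \<not> (\<exists>x y. subseq [x, y] \<rho> \<and> y < x)"
proof -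
  have "subseq [x, y, z] (\<rho> @ m # \<omega>) \<and> y < x \<and> x < z \<longleftrightarrow>
      subseq [x, y, z] (\<rho> @ \<omega>) \<and> y < x \<and> x < z \<or>
      z = m \<and> subseq [x, y] \<rho> \<and> y < x" for x y z
  proof -
    have "x \<in> set \<rho> \<Longrightarrow> x < m" "z \<in> set \<omega> \<Longrightarrow> z < m" using max by auto
    then show ?thesis
      unfolding subseq_three_insert_iff
      using subseq_less_max(1)[of y z] subseq_less_max(2)[of x y] subseq_less_max(3)[of x y z]
      by auto
  qed
  then show ?thesis unfolding avoids_def contains_pattern_213 by blast
qed

lemma avoids_231_insert_max:
  "avoids (\<rho> @ m # \<omega>) [2, 3, 1] \<longleftrightarrow>
     avoids (\<rho> @ \<omega>) [2, 3, 1] \<and> \<not> (\<exists>x\<in>set \<rho>. \<exists>z\<in>set \<omega>. z < x)"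
proof -
  have "subseq [x, y, z] (\<rho> @ m # \<omega>) \<and> z < x \<and> x < y \<longleftrightarrow>
      subseq [x, y, z] (\<rho> @ \<omega>) \<and> z < x \<and> x < y \<or>
      y = m \<and> x \<in> set \<rho> \<and> z \<in> set \<omega> \<and> z < x" for x y z
  proof -
    have "x \<in> set \<rho> \<Longrightarrow> x < m" "z \<in> set \<omega> \<Longrightarrow> z < m" using max by auto
    then show ?thesis
      unfolding subseq_three_insert_iff
      using subseq_less_max(1)[of y z] subseq_less_max(2)[of x y] subseq_less_max(3)[of x y z]
      by auto
  qed
  then show ?thesis unfolding avoids_def contains_pattern_231 by blast
qed

text \<open>
  The maximum can only be the top of a double descent, which needs two entries after it.
\<close>

lemma has_double_descent_insert_max:
  assumes "length \<omega> \<le> 1" "has_double_descent (\<rho> @ m # \<omega>)"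
  shows "has_double_descent (\<rho> @ \<omega>)"
proof -
  let ?\<pi> = "\<rho> @ m # \<omega>"
  from assms obtain i where i: "i + 2 < length ?\<pi>"
    "?\<pi> ! i > ?\<pi> ! (i + 1)" "?\<pi> ! (i + 1) > ?\<pi> ! (i + 2)"
    by (auto simp: has_double_descent_def)
  have less: "?\<pi> ! j < m" if "j < length \<rho>" for j
    using max that by (simp add: nth_append)
  have "i + 2 \<noteq> length \<rho>"
    using i(3) less[of "i + 1"] by auto
  moreover have "i + 1 \<noteq> length \<rho>"
    using i(2) less[of i] by auto
  ultimately have "i + 2 < length \<rho>" using i(1) assms(1) by auto
  then show ?thesis using i unfolding has_double_descent_def
    by (intro exI[of _ i]) (auto simp: nth_append)
qed

end

lemma simsunD:
  "simsun \<pi> \<Longrightarrow> 3 \<le> k \<Longrightarrow> k \<le> length \<pi> \<Longrightarrow>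
    \<not> has_double_descent (filter (\<lambda>x. x \<in> {1..k}) \<pi>)"
  unfolding simsun_def by blast

text \<open>
  Restricting to the entries up to \<open>k \<le> n\<close> drops the maximum, so the two lists differ only
  in the condition for \<open>k = Suc n\<close>, which concerns the whole list.
\<close>

lemma simsun_insert_max_iff:
  assumes "\<rho> @ \<omega> \<in> permutations_of_set {1..n}" "length \<omega> \<le> 1"
  shows "simsun (\<rho> @ Suc n # \<omega>) \<longleftrightarrow> simsun (\<rho> @ \<omega>)"
proof -
  let ?\<tau> = "\<rho> @ \<omega>" and ?\<pi> = "\<rho> @ Suc n # \<omega>"
  have set: "set ?\<tau> = {1..n}" and len: "length ?\<tau> = n"
    using assms(1) length_finite_permutations_of_set[OF assms(1)]
    by (simp_all add: permutations_of_set_def)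
  have eq: "filter (\<lambda>x. x \<in> {1..k}) ?\<pi> = filter (\<lambda>x. x \<in> {1..k}) ?\<tau>" if "k \<le> n" for k
    using that by simp
  have top: "filter (\<lambda>x. x \<in> {1..Suc n}) ?\<pi> = ?\<pi>"
    using set by (intro filter_True) auto
  have top': "filter (\<lambda>x. x \<in> {1..n}) ?\<tau> = ?\<tau>"
    using set by (intro filter_True) auto
  show ?thesis
  proof
    assume "simsun ?\<pi>"
    then show "simsun ?\<tau>"
      unfolding simsun_def using eq len by force
  next
    assume s: "simsun ?\<tau>"
    have no: "\<not> has_double_descent ?\<pi>"
    proof
      assume "has_double_descent ?\<pi>"
      then have dd: "has_double_descent ?\<tau>"
        using has_double_descent_insert_max[of \<rho> \<omega> "Suc n"] set assms(2) by fastforce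
      \<comment> \<open>A double descent needs three entries, so the simsun condition applies with \<open>k = n\<close>.\<close>
      then have "3 \<le> n" using len by (auto simp: has_double_descent_def)
      then show False using simsunD[OF s, of n] dd len top' by simp
    qed
    show "simsun ?\<pi>" unfolding simsun_def
    proof (intro allI impI)
      fix k assume k: "3 \<le> k \<and> k \<le> length ?\<pi>"
      show "\<not> has_double_descent (filter (\<lambda>x. x \<in> {1..k}) ?\<pi>)"
      proof (cases "k \<le> n")
        case True
        then show ?thesis using simsunD[OF s, of k] eq len k by simp
      next
        case False
        then have "k = Suc n" using k len by simp
        then show ?thesis using no top by simp
      qed
    qed
  qed
qed

section \<open>Generating the simsun permutations that avoid 312\<close>

lemma RS_set: "\<pi> \<in> RS n \<sigma> \<tau> \<Longrightarrow> set \<pi> = {1..n}"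
  by (simp add: RS_def permutations_of_set_def)

lemma RS_less_Suc: "\<pi> \<in> RS n \<sigma> \<tau> \<Longrightarrow> \<forall>x\<in>set \<pi>. x < Suc n"
  by (auto dest!: RS_set)

lemma permutations_insert_max_iff:
  "\<rho> @ Suc n # \<omega> \<in> permutations_of_set {1..Suc n} \<longleftrightarrow>
     \<rho> @ \<omega> \<in> permutations_of_set {1..n}"
proof -
  have "{1..Suc n} = insert (Suc n) {1..n}" "Suc n \<notin> {1..n}" by auto
  moreover have "set (\<rho> @ Suc n # \<omega>) = insert (Suc n) (set (\<rho> @ \<omega>))" by simp
  moreover have "distinct (\<rho> @ Suc n # \<omega>) \<longleftrightarrow> Suc n \<notin> set (\<rho> @ \<omega>) \<and> distinct (\<rho> @ \<omega>)"
    by auto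
  ultimately show ?thesis
    unfolding permutations_of_set_def mem_Collect_eq by (metis insert_ident)
qed

text \<open>
  With at most one entry behind it the maximum creates neither a double descent nor a 312,
  so only the pattern \<open>\<sigma>\<close> can forbid the insertion.
\<close>

lemma RS_insert_max_iff:
  assumes "length \<omega> \<le> 1"
  shows "\<rho> @ Suc n # \<omega> \<in> RS (Suc n) \<sigma> [3, 1, 2] \<longleftrightarrow>
     \<rho> @ \<omega> \<in> RS n \<sigma> [3, 1, 2] \<and> avoids (\<rho> @ Suc n # \<omega>) \<sigma>"
proof (cases "\<rho> @ \<omega> \<in> permutations_of_set {1..n}")
  case True
  then have less: "\<forall>x\<in>set (\<rho> @ \<omega>). x < Suc n"
    by (auto simp: permutations_of_set_def)
  have "\<not> subseq [y, z] \<omega>" for y z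
    using assms by (auto dest!: list_emb_length)
  then have a312: "avoids (\<rho> @ Suc n # \<omega>) [3, 1, 2] \<longleftrightarrow> avoids (\<rho> @ \<omega>) [3, 1, 2]"
    using avoids_312_insert_max[OF less] by blast
  have "subseq (\<rho> @ \<omega>) (\<rho> @ Suc n # \<omega>)"
    by (simp add: list_emb_append_mono list_emb_Cons)
  then have "avoids (\<rho> @ Suc n # \<omega>) \<sigma> \<Longrightarrow> avoids (\<rho> @ \<omega>) \<sigma>"
    using avoids_subseq by blast
  with True a312 show ?thesis
    unfolding RS_def mem_Collect_eq permutations_insert_max_iff
    using simsun_insert_max_iff[OF True assms] by blast
next
  case False
  then show ?thesis unfolding RS_def mem_Collect_eq permutations_insert_max_iff by blast
qed

text \<open>
  Two entries after the maximum are fatal: an ascent directly behind it gives a 312, a descent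
  a double descent.
\<close>

lemma RS_max_near_end:
  assumes "\<pi> \<in> RS (Suc n) \<sigma> [3, 1, 2]"
  obtains \<rho> \<omega> where "\<pi> = \<rho> @ Suc n # \<omega>" "length \<omega> \<le> 1"
proof -
  from assms have perm: "\<pi> \<in> permutations_of_set {1..Suc n}" and simsun: "simsun \<pi>"
    and av: "avoids \<pi> [3, 1, 2]" by (auto simp: RS_def)
  have "Suc n \<in> set \<pi>" using RS_set[OF assms] by simp
  then obtain \<rho> \<omega> where \<pi>: "\<pi> = \<rho> @ Suc n # \<omega>" by (meson split_list)
  then have "\<rho> @ \<omega> \<in> permutations_of_set {1..n}"
    using perm permutations_insert_max_iff by simp
  then have less: "\<forall>x\<in>set (\<rho> @ \<omega>). x < Suc n" and dist: "distinct (\<rho> @ \<omega>)"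
    by (auto simp: permutations_of_set_def)
  have "length \<omega> \<le> 1"
  proof (rule ccontr)
    assume "\<not> length \<omega> \<le> 1"
    then obtain a b \<omega>' where \<omega>: "\<omega> = a # b # \<omega>'"
      by (cases \<omega> rule: list.exhaust; cases "tl \<omega>") auto
    have "\<not> a < b"
      using av avoids_312_insert_max[OF less] unfolding \<pi> \<omega> by auto
    then have "b < a" using dist unfolding \<omega> by auto
    moreover have "a < Suc n" using less \<omega> by simp
    ultimately have "has_double_descent \<pi>"
      unfolding has_double_descent_def \<pi> \<omega>
      by (intro exI[of _ "length \<rho>"]) (simp add: nth_append)
    moreover have "length \<pi> = Suc n" "3 \<le> length \<pi>"
      using length_finite_permutations_of_set[OF perm] by (simp_all add: \<pi> \<omega>)
    moreover have "filter (\<lambda>x. x \<in> {1..Suc n}) \<pi> = \<pi>"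
      using RS_set[OF assms] by (intro filter_True) auto
    ultimately show False using simsunD[OF simsun, of "Suc n"] by simp
  qed
  with \<pi> show ?thesis using that by blast
qed

lemma RS_Suc_iff:
  "\<pi> \<in> RS (Suc n) \<sigma> [3, 1, 2] \<longleftrightarrow>
     (\<exists>\<tau>\<in>RS n \<sigma> [3, 1, 2]. \<pi> = \<tau> @ [Suc n] \<and> avoids \<pi> \<sigma>) \<or>
     (\<exists>\<rho> c. \<rho> @ [c] \<in> RS n \<sigma> [3, 1, 2] \<and> \<pi> = \<rho> @ [Suc n, c] \<and> avoids \<pi> \<sigma>)"
  (is "_ \<longleftrightarrow> ?last \<or> ?second_last")
proof
  assume *: "\<pi> \<in> RS (Suc n) \<sigma> [3, 1, 2]"
  then obtain \<rho> \<omega> where \<pi>: "\<pi> = \<rho> @ Suc n # \<omega>" "length \<omega> \<le> 1"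
    by (rule RS_max_near_end)
  from * have "\<rho> @ \<omega> \<in> RS n \<sigma> [3, 1, 2] \<and> avoids \<pi> \<sigma>"
    unfolding \<pi>(1) RS_insert_max_iff[OF \<pi>(2)] .
  moreover have "\<omega> = [] \<or> (\<exists>c. \<omega> = [c])"
    using \<pi>(2) by (cases \<omega>) auto
  ultimately show "?last \<or> ?second_last" using \<pi>(1) by auto
next
  assume "?last \<or> ?second_last"
  then show "\<pi> \<in> RS (Suc n) \<sigma> [3, 1, 2]"
    using RS_insert_max_iff[of "[]"] RS_insert_max_iff[of "[c]" for c] by auto
qed

lemma RS_0: "\<sigma> \<noteq> [] \<Longrightarrow> \<tau> \<noteq> [] \<Longrightarrow> RS 0 \<sigma> \<tau> = {[]}"
  by (auto simp: RS_def simsun_def avoids_def contains_pattern_def)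

lemma finite_RS: "finite (RS n \<sigma> \<tau>)"
  by (rule finite_subset[of _ "permutations_of_set {1..n}"]) (auto simp: RS_def)

section \<open>Avoiding 132 and 312\<close>

text \<open>
  Before \<open>c\<close> at the end of a permutation there is no smaller entry only if \<open>c\<close> is the minimum.
\<close>

lemma RS_132_Suc_iff:
  "\<pi> \<in> RS (Suc n) [1, 3, 2] [3, 1, 2] \<longleftrightarrow>
     (\<exists>\<tau>\<in>RS n [1, 3, 2] [3, 1, 2]. \<pi> = \<tau> @ [Suc n]) \<or>
     (\<exists>\<rho>. \<rho> @ [1] \<in> RS n [1, 3, 2] [3, 1, 2] \<and> \<pi> = \<rho> @ [Suc n, 1])"
proof -
  let ?R = "RS n [1, 3, 2] [3, 1, 2]"
  have last: "avoids (\<tau> @ [Suc n]) [1, 3, 2]" if "\<tau> \<in> ?R" for \<tau>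
    using avoids_132_insert_max[of \<tau> "[]" "Suc n"] RS_less_Suc[OF that] that
    by (simp add: RS_def)
  have second_last: "avoids (\<rho> @ [Suc n, c]) [1, 3, 2] \<longleftrightarrow> c = 1" if "\<rho> @ [c] \<in> ?R" for \<rho> c
  proof -
    have set: "insert c (set \<rho>) = {1..n}" using RS_set[OF that] by simp
    have "(\<forall>x\<in>set \<rho>. \<not> x < c) \<longleftrightarrow> c = 1"
    proof
      assume no: "\<forall>x\<in>set \<rho>. \<not> x < c"
      have "c \<in> {1..n}" using set by blast
      then have "1 \<in> insert c (set \<rho>)" using set by simp
      then show "c = 1" using no \<open>c \<in> {1..n}\<close> by auto
    next
      assume "c = 1"
      moreover have "\<forall>x\<in>set \<rho>. x \<in> {1..n}" using set by blast
      ultimately show "\<forall>x\<in>set \<rho>. \<not> x < c" by auto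
    qed
    then show ?thesis
      using avoids_132_insert_max[of \<rho> "[c]" "Suc n"] RS_less_Suc[OF that] that
      by (auto simp: RS_def)
  qed
  show ?thesis unfolding RS_Suc_iff using last second_last by blast
qed

text \<open>
  A member of size at least 2 that ends in 1 cannot come from appending its maximum, so it
  comes from the unique smaller member that ends in 1.
\<close>

lemma RS_132_last_1:
  assumes "n \<ge> 1"
  shows "\<rho> @ [1] \<in> RS n [1, 3, 2] [3, 1, 2] \<longleftrightarrow> \<rho> = [2..<Suc n]"
  using assms
proof (induction n arbitrary: \<rho> rule: nat_induct_at_least)
  case base
  show ?case by (simp add: RS_132_Suc_iff[of _ 0, simplified] RS_0)
next
  case (Suc n)
  then have "\<rho> @ [1] \<in> RS (Suc n) [1, 3, 2] [3, 1, 2] \<longleftrightarrow>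
      (\<exists>\<rho>'. \<rho>' @ [1] \<in> RS n [1, 3, 2] [3, 1, 2] \<and> \<rho> = \<rho>' @ [Suc n])"
    unfolding RS_132_Suc_iff by auto
  with Suc show ?case by simp
qed

lemma card_RS_132: "n \<ge> 1 \<Longrightarrow> card (RS n [1, 3, 2] [3, 1, 2]) = n"
proof (induction n rule: nat_induct_at_least)
  case base
  have "RS 1 [1, 3, 2] [3, 1, 2] = {[1]}"
    by (auto simp: RS_132_Suc_iff[of _ 0, simplified] RS_0)
  then show ?case by simp
next
  case (Suc n)
  let ?R = "RS n [1, 3, 2] [3, 1, 2]"
  have "RS (Suc n) [1, 3, 2] [3, 1, 2] =
      insert ([2..<Suc n] @ [Suc n, 1]) ((\<lambda>\<tau>. \<tau> @ [Suc n]) ` ?R)"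
    by (rule set_eqI) (unfold RS_132_Suc_iff RS_132_last_1[OF Suc.hyps], blast)
  moreover have "[2..<Suc n] @ [Suc n, 1] \<notin> (\<lambda>\<tau>. \<tau> @ [Suc n]) ` ?R"
    using Suc.hyps by auto
  moreover have "card ((\<lambda>\<tau>. \<tau> @ [Suc n]) ` ?R) = card ?R"
    by (intro card_image) (auto simp: inj_on_def)
  ultimately show ?case using Suc.IH finite_RS by simp
qed

section \<open>Avoiding 213 and 312\<close>

lemma sorted_iff_no_descending_pair:
  "sorted xs \<longleftrightarrow> \<not> (\<exists>x y. subseq [x, y] xs \<and> y < x)" for xs :: "nat list"
proof (induction xs)
  case (Cons a xs)
  have "subseq [x, y] (a # xs) \<longleftrightarrow> x = a \<and> y \<in> set xs \<or> subseq [x, y] xs" for x y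
    by (auto simp: subseq_singleton_left dest: subseq_set_subset)
  with Cons show ?case by (auto simp: not_less)
qed simp

lemma RS_213_Suc_iff:
  "\<pi> \<in> RS (Suc n) [2, 1, 3] [3, 1, 2] \<longleftrightarrow>
     (\<exists>\<tau>\<in>RS n [2, 1, 3] [3, 1, 2]. \<pi> = \<tau> @ [Suc n] \<and> sorted \<tau>) \<or>
     (\<exists>\<rho> c. \<rho> @ [c] \<in> RS n [2, 1, 3] [3, 1, 2] \<and> \<pi> = \<rho> @ [Suc n, c] \<and> sorted \<rho>)"
proof -
  let ?R = "RS n [2, 1, 3] [3, 1, 2]"
  have av: "avoids (\<rho> @ Suc n # \<omega>) [2, 1, 3] \<longleftrightarrow> sorted \<rho>" if "\<rho> @ \<omega> \<in> ?R" for \<rho> \<omega>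
    using avoids_213_insert_max[of \<rho> \<omega> "Suc n"] RS_less_Suc[OF that] that
    by (simp add: RS_def sorted_iff_no_descending_pair)
  show ?thesis unfolding RS_Suc_iff using av[of _ "[]"] av[of _ "[c]" for c] by auto
qed

text \<open>
  The maximum stands at the end or just before it, with an increasing prefix in front of it;
  either way dropping the last entry leaves an increasing list.
\<close>

lemma sorted_butlast_RS_213:
  assumes "\<rho> @ [c] \<in> RS n [2, 1, 3] [3, 1, 2]"
  shows "sorted \<rho>"
proof (cases n)
  case 0
  with assms show ?thesis by (simp add: RS_0)
next
  case (Suc m)
  show ?thesis
    using assms RS_less_Suc unfolding Suc RS_213_Suc_iff
    by (fastforce simp: sorted_append)
qed

lemma upt_in_RS_213: "[1..<Suc n] \<in> RS n [2, 1, 3] [3, 1, 2]"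
proof (induction n)
  case (Suc n)
  then have "[1..<Suc n] @ [Suc n] \<in> RS (Suc n) [2, 1, 3] [3, 1, 2]"
    unfolding RS_213_Suc_iff using sorted_upt by blast
  then show ?case by simp
qed (simp add: RS_0)

text \<open>
  Being increasing singles out the identity among the members that can be extended by
  appending, while \<open>sorted_butlast_RS_213\<close> makes the condition void for the other insertion.
\<close>

lemma RS_213_Suc:
  assumes "n \<ge> 1"
  shows "RS (Suc n) [2, 1, 3] [3, 1, 2] =
    insert ([1..<Suc n] @ [Suc n])
      ((\<lambda>\<tau>. butlast \<tau> @ [Suc n, last \<tau>]) ` RS n [2, 1, 3] [3, 1, 2])" (is "_ = ?rhs")
proof -
  let ?R = "RS n [2, 1, 3] [3, 1, 2]"
  have id: "\<tau> = [1..<Suc n]" if "\<tau> \<in> ?R" "sorted \<tau>" for \<tau>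
  proof (rule sorted_distinct_set_unique[OF that(2) _ sorted_upt distinct_upt])
    show "distinct \<tau>" using that(1) by (simp add: RS_def permutations_of_set_def)
    show "set \<tau> = set [1..<Suc n]" 
      unfolding RS_set[OF that(1)] set_upt atLeastLessThanSuc_atLeastAtMost ..
  qed
  have ne: "\<tau> \<noteq> []" if "\<tau> \<in> ?R" for \<tau>
  proof
    assume "\<tau> = []"
    then show False using RS_set[OF that] assms by simp
  qed
  have "\<pi> \<in> RS (Suc n) [2, 1, 3] [3, 1, 2] \<longleftrightarrow> \<pi> \<in> ?rhs" for \<pi>
  proof -
    have "(\<exists>\<tau>\<in>?R. \<pi> = \<tau> @ [Suc n] \<and> sorted \<tau>) \<longleftrightarrow> \<pi> = [1..<Suc n] @ [Suc n]"
    proof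
      assume "\<exists>\<tau>\<in>?R. \<pi> = \<tau> @ [Suc n] \<and> sorted \<tau>"
      then obtain \<tau> where \<tau>: "\<tau> \<in> ?R" "\<pi> = \<tau> @ [Suc n]" "sorted \<tau>" by blast
      show "\<pi> = [1..<Suc n] @ [Suc n]" unfolding \<tau>(2) id[OF \<tau>(1,3)] ..
    next
      assume "\<pi> = [1..<Suc n] @ [Suc n]"
      then show "\<exists>\<tau>\<in>?R. \<pi> = \<tau> @ [Suc n] \<and> sorted \<tau>"
        using upt_in_RS_213[of n] sorted_upt[of 1 "Suc n"] by blast
    qed
    moreover have "(\<exists>\<rho> c. \<rho> @ [c] \<in> ?R \<and> \<pi> = \<rho> @ [Suc n, c] \<and> sorted \<rho>) \<longleftrightarrow>
        \<pi> \<in> (\<lambda>\<tau>. butlast \<tau> @ [Suc n, last \<tau>]) ` ?R"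
    proof
      assume "\<exists>\<rho> c. \<rho> @ [c] \<in> ?R \<and> \<pi> = \<rho> @ [Suc n, c] \<and> sorted \<rho>"
      then obtain \<rho> c where "\<rho> @ [c] \<in> ?R" "\<pi> = \<rho> @ [Suc n, c]" by blast
      then show "\<pi> \<in> (\<lambda>\<tau>. butlast \<tau> @ [Suc n, last \<tau>]) ` ?R"
        by (intro image_eqI[of _ _ "\<rho> @ [c]"]) simp_all
    next
      assume "\<pi> \<in> (\<lambda>\<tau>. butlast \<tau> @ [Suc n, last \<tau>]) ` ?R"
      then obtain \<tau> where "\<tau> \<in> ?R" "\<pi> = butlast \<tau> @ [Suc n, last \<tau>]" by blast
      moreover from this have "butlast \<tau> @ [last \<tau>] \<in> ?R" using ne by simp
      ultimately show "\<exists>\<rho> c. \<rho> @ [c] \<in> ?R \<and> \<pi> = \<rho> @ [Suc n, c] \<and> sorted \<rho>"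
        using sorted_butlast_RS_213 by blast
    qed
    ultimately show ?thesis unfolding RS_213_Suc_iff by blast
  qed
  then show ?thesis by blast
qed

lemma card_RS_213: "n \<ge> 1 \<Longrightarrow> card (RS n [2, 1, 3] [3, 1, 2]) = n"
proof (induction n rule: nat_induct_at_least)
  case base
  have "RS 1 [2, 1, 3] [3, 1, 2] = {[1]}"
    by (auto simp: RS_213_Suc_iff[of _ 0, simplified] RS_0)
  then show ?case by simp
next
  case (Suc n)
  let ?R = "RS n [2, 1, 3] [3, 1, 2]"
  let ?f = "\<lambda>\<tau>. butlast \<tau> @ [Suc n, last \<tau>]"
  have ne: "\<tau> \<noteq> []" if "\<tau> \<in> ?R" for \<tau>
    using RS_set[OF that] Suc.hyps by auto
  have "[1..<Suc n] @ [Suc n] \<notin> ?f ` ?R"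
  proof
    \<comment> \<open>Insertion before the last entry keeps an old, hence smaller, entry at the end.\<close>
    assume "[1..<Suc n] @ [Suc n] \<in> ?f ` ?R"
    then obtain \<tau> where \<tau>: "\<tau> \<in> ?R" "last \<tau> = Suc n" by auto
    then show False using RS_less_Suc[OF \<tau>(1)] ne last_in_set by fastforce
  qed
  moreover have "inj_on ?f ?R"
  proof (rule inj_onI)
    fix \<tau> \<tau>' assume *: "\<tau> \<in> ?R" "\<tau>' \<in> ?R" "?f \<tau> = ?f \<tau>'"
    then have "butlast \<tau> @ [last \<tau>] = butlast \<tau>' @ [last \<tau>']" by simp
    then show "\<tau> = \<tau>'" using ne[OF *(1)] ne[OF *(2)] by simp
  qed
  ultimately show ?case
    unfolding RS_213_Suc[OF Suc.hyps]
    using Suc.IH finite_RS[of n "[2, 1, 3]" "[3, 1, 2]"] by (simp add: card_image)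
qed

section \<open>Avoiding 231 and 312\<close>

lemma RS_231_append_max_iff:
  "\<tau> @ [Suc n] \<in> RS (Suc n) [2, 3, 1] [3, 1, 2] \<longleftrightarrow> \<tau> \<in> RS n [2, 3, 1] [3, 1, 2]"
proof -
  have "avoids (\<tau> @ [Suc n]) [2, 3, 1]" if "\<tau> \<in> RS n [2, 3, 1] [3, 1, 2]"
    using avoids_231_insert_max[of \<tau> "[]" "Suc n"] RS_less_Suc[OF that] that
    by (simp add: RS_def)
  then show ?thesis using RS_insert_max_iff[of "[]" \<tau>] by auto
qed

text \<open>
  The new maximum may precede a last entry \<open>c\<close> only if \<open>c\<close> exceeds everything before it, so
  \<open>c\<close> is the old maximum. By \<open>RS_231_append_max_iff\<close> the part before \<open>c\<close> is then an arbitrary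
  member that is smaller by two. So these permutations are direct sums of blocks 1 and 21.
\<close>

lemma RS_231_Suc_Suc:
  "RS (Suc (Suc n)) [2, 3, 1] [3, 1, 2] =
     (\<lambda>\<tau>. \<tau> @ [Suc (Suc n)]) ` RS (Suc n) [2, 3, 1] [3, 1, 2] \<union>
     (\<lambda>\<rho>. \<rho> @ [Suc (Suc n), Suc n]) ` RS n [2, 3, 1] [3, 1, 2]" (is "_ = ?rhs")
proof -
  let ?R = "\<lambda>n. RS n [2, 3, 1] [3, 1, 2]"
  have last: "avoids (\<tau> @ [Suc (Suc n)]) [2, 3, 1]" if "\<tau> \<in> ?R (Suc n)" for \<tau>
    using that RS_231_append_max_iff[of \<tau> "Suc n"] by (simp add: RS_def)
  have second_last: "avoids (\<rho> @ [Suc (Suc n), c]) [2, 3, 1] \<longleftrightarrow> c = Suc n"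
    if "\<rho> @ [c] \<in> ?R (Suc n)" for \<rho> c
  proof -
    have set: "insert c (set \<rho>) = {1..Suc n}" using RS_set[OF that] by simp
    have "(\<forall>x\<in>set \<rho>. \<not> c < x) \<longleftrightarrow> c = Suc n"
    proof
      assume no: "\<forall>x\<in>set \<rho>. \<not> c < x"
      have "c \<in> {1..Suc n}" using set by blast
      moreover have "Suc n \<in> insert c (set \<rho>)" using set by simp
      ultimately show "c = Suc n" using no by auto
    next
      assume "c = Suc n"
      moreover have "\<forall>x\<in>set \<rho>. x \<in> {1..Suc n}" using set by blast
      ultimately show "\<forall>x\<in>set \<rho>. \<not> c < x" by auto
    qed
    then show ?thesis
      using avoids_231_insert_max[of \<rho> "[c]" "Suc (Suc n)"] RS_less_Suc[OF that] that
      by (auto simp: RS_def)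
  qed
  have "\<pi> \<in> ?R (Suc (Suc n)) \<longleftrightarrow> (\<exists>\<tau>\<in>?R (Suc n). \<pi> = \<tau> @ [Suc (Suc n)]) \<or>
     (\<exists>\<rho>. \<rho> @ [Suc n] \<in> ?R (Suc n) \<and> \<pi> = \<rho> @ [Suc (Suc n), Suc n])" for \<pi>
    unfolding RS_Suc_iff[of _ "Suc n"] using last second_last by blast
  then show ?thesis unfolding RS_231_append_max_iff by blast
qed

lemma card_RS_231: "card (RS n [2, 3, 1] [3, 1, 2]) = fib (Suc n)"
proof (induction n rule: fib.induct)
  case 1
  show ?case by (simp add: RS_0)
next
  case 2
  have "RS (Suc 0) [2, 3, 1] [3, 1, 2] = {[1]}"
    using RS_231_append_max_iff[of "[]" 0] RS_Suc_iff[of _ 0 "[2, 3, 1]"] by (auto simp: RS_0)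
  then show ?case by simp
next
  case (3 n)
  let ?R = "\<lambda>n. RS n [2, 3, 1] [3, 1, 2]"
  have "card (?R (Suc (Suc n))) =
      card ((\<lambda>\<tau>. \<tau> @ [Suc (Suc n)]) ` ?R (Suc n)) +
      card ((\<lambda>\<rho>. \<rho> @ [Suc (Suc n), Suc n]) ` ?R n)"
    unfolding RS_231_Suc_Suc by (intro card_Un_disjoint finite_imageI finite_RS) auto
  also have "\<dots> = card (?R (Suc n)) + card (?R n)"
    by (intro arg_cong2[where f = "(+)"] card_image) (auto simp: inj_on_def)
  finally show ?case using 3 by simp
qed

section \<open>The three counts\<close>

theorem lemma7p7:
  fixes n :: nat
  assumes "n \<ge> 1"
  shows "card (RS n [1, 3, 2] [3, 1, 2]) = n \<and>
         card (RS n [2, 1, 3] [3, 1, 2]) = n \<and>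
         card (RS n [2, 3, 1] [3, 1, 2]) = fib (n + 1)"
  using assms card_RS_132 card_RS_213 card_RS_231 by simp

end
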